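(* Let $n\ge 3$, let $\Gamma$ and $\Gamma'$ be generalized $n$-gons and let $\phi:\Gamma\to\Gamma'$ be an epimorphism. If $\Gamma$ is a Moufang generalized polygon, then $\Gamma'$ is a Moufang generalized polygon.
   Context: A generalized $n$-gon is a rank 2 geometry $(\mathcal P,\mathcal L,\mathtt I)$ (points, lines, incidence; an element is a point or a line) such that every element is incident with at least three elements, any two elements are joined by a non-stammering path (a sequence of consecutively incident elements $(y_0,\dots,y_k)$, of length $k$, with $y_i\ne y_{i+2}$ for all $i$) of length at most $n$, and this path is unique if its length is $<n$. An epimorphism $\Gamma\to\Gamma'$ is a map from the elements of $\Gamma$ onto the elements of $\Gamma'$ sending points to points, lines to lines and incident elements to incident elements (so the image is again a generalized $n$-gon with at least three elements incident with every element). A root is a non-stammering path $(x_0,\dots,x_n)$ of length $n$. A root elation of it is an automorphism fixing every element incident with one of $x_1,\dots,x_{n-1}$; these form its root group. The root is Moufang if its root group acts transitively on the elements incident with $x_0$ and different from $x_1$. For $n\ge3$ a generalized $n$-gon is Moufang if all its roots are Moufang. *)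

theory Defs
  imports Main "HOL-Combinatorics.Permutations"
begin

record 'a geometry =
  points :: "'a set"
  lines :: "'a set"
  inc :: "('a \<times> 'a) set"

definition rank2_geometry :: "'a geometry \<Rightarrow> bool" where
  "rank2_geometry G \<longleftrightarrow>
     points G \<noteq> {} \<and> lines G \<noteq> {} \<and> points G \<inter> lines G = {} \<and>
     inc G \<subseteq> points G \<times> lines G"

definition elements :: "'a geometry \<Rightarrow> 'a set" where
  "elements G = points G \<union> lines G"

text \<open>\<open>inc\<close> relates points to lines; \<open>incident\<close> is its symmetric closure on elements.\<close>

definition incident :: "'a geometry \<Rightarrow> 'a \<Rightarrow> 'a \<Rightarrow> bool" where
  "incident G x y \<longleftrightarrow> (x, y) \<in> inc G \<or> (y, x) \<in> inc G"

text \<open>A path of length \<open>k\<close> is a list of \<open>k + 1\<close> elements.\<close>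

definition non_stammering_path :: "'a geometry \<Rightarrow> nat \<Rightarrow> 'a list \<Rightarrow> bool" where
  "non_stammering_path G k ys \<longleftrightarrow>
     length ys = k + 1 \<and> set ys \<subseteq> elements G \<and>
     (\<forall>i<k. incident G (ys ! i) (ys ! (i + 1))) \<and>
     (\<forall>i. i + 2 \<le> k \<longrightarrow> ys ! i \<noteq> ys ! (i + 2))"

definition joins :: "'a geometry \<Rightarrow> nat \<Rightarrow> 'a list \<Rightarrow> 'a \<Rightarrow> 'a \<Rightarrow> bool" where
  "joins G k ys x y \<longleftrightarrow> non_stammering_path G k ys \<and> hd ys = x \<and> last ys = y"

definition generalized_polygon :: "nat \<Rightarrow> 'a geometry \<Rightarrow> bool" where
  "generalized_polygon n G \<longleftrightarrow>
     rank2_geometry G \<and>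
     (\<forall>x\<in>elements G. \<exists>a b c. a \<noteq> b \<and> b \<noteq> c \<and> a \<noteq> c \<and>
        incident G x a \<and> incident G x b \<and> incident G x c) \<and>
     (\<forall>x\<in>elements G. \<forall>y\<in>elements G. \<exists>k\<le>n. \<exists>ys. joins G k ys x y) \<and>
     (\<forall>x\<in>elements G. \<forall>y\<in>elements G. \<forall>k l ys zs.
        k < n \<longrightarrow> l \<le> n \<longrightarrow> joins G k ys x y \<longrightarrow> joins G l zs x y \<longrightarrow> zs = ys)"

definition epimorphism :: "'a geometry \<Rightarrow> 'b geometry \<Rightarrow> ('a \<Rightarrow> 'b) \<Rightarrow> bool" where
  "epimorphism G G' \<phi> \<longleftrightarrow>
     \<phi> ` elements G = elements G' \<and>
     \<phi> ` points G \<subseteq> points G' \<and> \<phi> ` lines G \<subseteq> lines G' \<and>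
     (\<forall>x y. incident G x y \<longrightarrow> incident G' (\<phi> x) (\<phi> y))"

text \<open>Automorphisms are taken to be the identity outside the set of elements (part of
  \<open>permutes\<close>), so that distinct functions are distinct automorphisms.\<close>

definition automorphism :: "'a geometry \<Rightarrow> ('a \<Rightarrow> 'a) \<Rightarrow> bool" where
  "automorphism G g \<longleftrightarrow>
     g permutes elements G \<and> g ` points G = points G \<and> g ` lines G = lines G \<and>
     (\<forall>x\<in>elements G. \<forall>y\<in>elements G. incident G (g x) (g y) \<longleftrightarrow> incident G x y)"

definition root :: "nat \<Rightarrow> 'a geometry \<Rightarrow> 'a list \<Rightarrow> bool" where
  "root n G xs \<longleftrightarrow> non_stammering_path G n xs"

definition root_group :: "nat \<Rightarrow> 'a geometry \<Rightarrow> 'a list \<Rightarrow> ('a \<Rightarrow> 'a) set" where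
  "root_group n G xs =
     {g. automorphism G g \<and>
         (\<forall>i y. 1 \<le> i \<longrightarrow> i < n \<longrightarrow> incident G (xs ! i) y \<longrightarrow> g y = y)}"

definition moufang_root :: "nat \<Rightarrow> 'a geometry \<Rightarrow> 'a list \<Rightarrow> bool" where
  "moufang_root n G xs \<longleftrightarrow> root n G xs \<and>
     (\<forall>y z. incident G (xs ! 0) y \<longrightarrow> y \<noteq> xs ! 1 \<longrightarrow>
            incident G (xs ! 0) z \<longrightarrow> z \<noteq> xs ! 1 \<longrightarrow>
            (\<exists>g\<in>root_group n G xs. g y = z))"

definition moufang_polygon :: "nat \<Rightarrow> 'a geometry \<Rightarrow> bool" where
  "moufang_polygon n G \<longleftrightarrow>
     n \<ge> 3 \<and> generalized_polygon n G \<and> (\<forall>xs. root n G xs \<longrightarrow> moufang_root n G xs)"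

end

theory Submission imports Defs begin

text \<open>
  Why the image of a Moufang polygon is Moufang. Fix a root \<open>\<alpha>'\<close> of \<open>\<Gamma>'\<close> and two elements \<open>y'\<close>, \<open>z'\<close>
  incident with its first element and different from its second. An epimorphism is surjective on
  the elements incident with any given element (\<open>epi_local_surj\<close>), so \<open>\<alpha>'\<close>, \<open>y'\<close>, \<open>z'\<close> lift to a root
  \<open>\<alpha> = (x\<^sub>0, \<dots>, x\<^sub>n)\<close> and elements \<open>y\<close>, \<open>z\<close> of \<open>\<Gamma>\<close>, and some root elation \<open>g\<close> of \<open>\<alpha>\<close> maps \<open>y\<close> to
  \<open>z\<close>. All that remains is that \<open>g\<close> descends, that is, that \<open>g\<close> permutes the fibres of \<open>\<phi>\<close>. This is
  false for root elations in general; it holds here because the images \<open>y'\<close> of \<open>y\<close> and \<open>z'\<close> of \<open>g y\<close>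
  both differ from the image of \<open>x\<^sub>1\<close>.

  The two epimorphisms \<open>\<phi>\<close> and \<open>\<psi> = \<phi> \<circ> g\<close> have to be shown to have the same kernel. Say that they
  agree at an element \<open>x\<close> if they identify the same pairs of elements incident with \<open>x\<close>. Agreement
  passes from \<open>p\<close> to \<open>q\<close> whenever \<open>p\<close> and \<open>q\<close> have opposite images under both maps, because the
  perspectivity from \<open>p\<close> to \<open>q\<close> commutes with epimorphisms (\<open>agree_opposite\<close>). At
  \<open>x\<^sub>1, \<dots>, x\<^sub>n\<^sub>-\<^sub>1\<close> the two maps agree trivially, since \<open>g\<close> fixes all elements incident
  with them. The hypothesis on \<open>y\<close> and \<open>g y\<close> says that the apartment through \<open>\<alpha>\<close> and \<open>y\<close> is mapped to an apartment by \<open>\<phi>\<close> and by \<open>\<psi>\<close>, and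
  opposition then gives agreement at all its elements (\<open>agreeing_apartment_exists\<close>). Such an
  apartment can be moved to any neighbouring element (\<open>agreeing_apartment_move\<close>), so by
  connectedness the two maps agree everywhere.

  Local agreement yields equality of the kernels (\<open>kernels_agree\<close>): two images are opposite exactly
  if the joining path has length \<open>n\<close> and its image does not stammer, which is a local condition, and
  an element of a thick polygon is determined by the elements opposite to it. Hence \<open>g\<close> induces an
  automorphism of \<open>\<Gamma>'\<close> (\<open>automorphism_descends\<close>), and by local surjectivity it is a root elation of
  \<open>\<alpha>'\<close> taking \<open>y'\<close> to \<open>z'\<close>.
\<close>

section \<open>Walks and stammering\<close>

definition walk :: "'a geometry \<Rightarrow> 'a list \<Rightarrow> bool" where
  "walk G ws \<longleftrightarrow> ws \<noteq> [] \<and> set ws \<subseteq> elements G \<and> successively (incident G) ws"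

text \<open>The map \<open>f\<close> is a parameter because the interesting condition on a walk is usually that its
  image under an epimorphism does not stammer; this is stronger than not stammering itself.\<close>

definition nostammer :: "('a \<Rightarrow> 'b) \<Rightarrow> 'a list \<Rightarrow> bool" where
  "nostammer f ws \<longleftrightarrow> (\<forall>i. i + 2 < length ws \<longrightarrow> f (ws ! i) \<noteq> f (ws ! (i + 2)))"

lemma last_take_nth: "0 < k \<Longrightarrow> k \<le> length ws \<Longrightarrow> last (take k ws) = ws ! (k - 1)"
  by (cases ws) (auto simp: last_conv_nth min_def)

lemma incident_sym: "incident G x y \<Longrightarrow> incident G y x"
  by (auto simp: incident_def)

lemma incident_elements:
  assumes "rank2_geometry G" "incident G x y"
  shows "x \<in> elements G" "y \<in> elements G"
  using assms by (auto simp: incident_def rank2_geometry_def elements_def)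

lemma incident_points:
  assumes "rank2_geometry G" "incident G x y"
  shows "x \<in> points G \<longleftrightarrow> y \<notin> points G"
  using assms by (auto simp: incident_def rank2_geometry_def)

lemma non_stammering_path_iff:
  "non_stammering_path G k ys \<longleftrightarrow> length ys = k + 1 \<and> walk G ys \<and> nostammer id ys"
  by (auto simp: non_stammering_path_def walk_def nostammer_def successively_conv_nth)

lemma nostammer_map: "nostammer id (map f ws) \<longleftrightarrow> nostammer f ws"
  by (auto simp: nostammer_def)

lemma walk_rev: "walk G ws \<Longrightarrow> walk G (rev ws)"
  by (auto simp: walk_def successively_rev intro: successively_mono incident_sym)

lemma nostammer_rev:
  assumes "nostammer f ws" shows "nostammer f (rev ws)"
  unfolding nostammer_def
proof (intro allI impI)
  fix i assume i: "i + 2 < length (rev ws)"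
  define j where "j = length ws - 3 - i"
  have "rev ws ! i = ws ! (j + 2)" "rev ws ! (i + 2) = ws ! j"
    using i by (auto simp: rev_nth j_def intro!: arg_cong[where f = "nth ws"])
  moreover have "j + 2 < length ws" using i by (auto simp: j_def)
  ultimately show "f (rev ws ! i) \<noteq> f (rev ws ! (i + 2))"
    using assms unfolding nostammer_def by metis
qed

lemma walk_append:
  "us \<noteq> [] \<Longrightarrow> vs \<noteq> [] \<Longrightarrow>
    walk G (us @ vs) \<longleftrightarrow> walk G us \<and> walk G vs \<and> incident G (last us) (hd vs)"
  by (auto simp: walk_def successively_append_iff)

lemma walk_Cons:
  "vs \<noteq> [] \<Longrightarrow> walk G (u # vs) \<longleftrightarrow> u \<in> elements G \<and> walk G vs \<and> incident G u (hd vs)"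
  by (cases vs) (auto simp: walk_def)

lemma walk_take: "walk G ws \<Longrightarrow> k > 0 \<Longrightarrow> walk G (take k ws)"
  using walk_append[of "take k ws" "drop k ws" G] by (cases "drop k ws = []") (auto simp: walk_def)

lemma walk_drop: "walk G ws \<Longrightarrow> k < length ws \<Longrightarrow> walk G (drop k ws)"
  using walk_append[of "take k ws" "drop k ws" G] by (cases "k = 0") (auto simp: walk_def)

lemma walk_ends: "walk G ws \<Longrightarrow> hd ws \<in> elements G \<and> last ws \<in> elements G"
  using last_in_set[of ws] hd_in_set[of ws] by (auto simp: walk_def simp del: last_in_set hd_in_set)

lemma walk_nth: "walk G ws \<Longrightarrow> i + 1 < length ws \<Longrightarrow> incident G (ws ! i) (ws ! (i + 1))"
  by (auto simp: walk_def successively_conv_nth)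

lemma nostammer_take: "nostammer f ws \<Longrightarrow> nostammer f (take k ws)"
  by (auto simp: nostammer_def)

lemma nostammer_drop: "nostammer f ws \<Longrightarrow> nostammer f (drop k ws)"
  by (auto simp: nostammer_def add.assoc)

lemma nostammer_Cons:
  "nostammer f (u # vs) \<longleftrightarrow> (1 < length vs \<longrightarrow> f u \<noteq> f (vs ! 1)) \<and> nostammer f vs"
proof -
  have "(\<forall>i. P i) \<longleftrightarrow> P 0 \<and> (\<forall>i. P (Suc i))" for P :: "nat \<Rightarrow> bool"
    by (metis nat.exhaust)
  from this[of "\<lambda>i. i + 2 < length (u # vs) \<longrightarrow> f ((u # vs) ! i) \<noteq> f ((u # vs) ! (i + 2))"]
  show ?thesis unfolding nostammer_def by simp
qed

lemma nostammer_glue: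
  assumes "nostammer f (us @ [b])" "nostammer f (b # vs)"
    and "us \<noteq> [] \<Longrightarrow> vs \<noteq> [] \<Longrightarrow> f (last us) \<noteq> f (hd vs)"
  shows "nostammer f (us @ b # vs)"
  unfolding nostammer_def
proof (intro allI impI)
  fix i assume i: "i + 2 < length (us @ b # vs)"
  consider "i + 2 \<le> length us" | "i + 1 = length us" | "length us \<le> i" by linarith
  then show "f ((us @ b # vs) ! i) \<noteq> f ((us @ b # vs) ! (i + 2))"
  proof cases
    case 1
    then have "f ((us @ [b]) ! i) \<noteq> f ((us @ [b]) ! (i + 2))"
      using assms(1) by (auto simp: nostammer_def)
    then show ?thesis using 1 by (auto simp: nth_append split: if_splits)
  next
    case 2
    then have "us \<noteq> []" "vs \<noteq> []" "i = length us - 1" using i by auto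
    moreover have "(us @ b # vs) ! i = last us" "(us @ b # vs) ! (i + 2) = hd vs"
      using calculation
      by (auto simp: nth_append last_conv_nth hd_conv_nth)
    ultimately show ?thesis using assms(3) by metis
  next
    case 3
    then have "f ((b # vs) ! (i - length us)) \<noteq> f ((b # vs) ! (i - length us + 2))"
      using assms(2) i by (auto simp: nostammer_def)
    then show ?thesis using 3 by (auto simp: nth_append Suc_diff_le)
  qed
qed

text \<open>Cutting out a back-and-forth \<open>(w\<^sub>i, w\<^sub>i\<^sub>+\<^sub>1, w\<^sub>i\<^sub>+\<^sub>2 = w\<^sub>i)\<close> shortens a walk by two. The bound \<open>k + 3\<close>
  records that a stammering walk of length \<open>l\<close> reduces to length at most \<open>l - 2\<close>; with \<open>l - 1\<close> only,
  walks of length \<open>n\<close> could not be compared with paths of length \<open>n - 1\<close> below.\<close>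

lemma walk_reduce:
  assumes "walk G ws"
  shows "\<exists>k zs. joins G k zs (hd ws) (last ws) \<and> (zs = ws \<or> k + 3 \<le> length ws)"
  using assms
proof (induction ws rule: length_induct)
  case (1 ws)
  show ?case
  proof (cases "nostammer id ws")
    case True
    then have "joins G (length ws - 1) ws (hd ws) (last ws)"
      using 1 by (auto simp: joins_def non_stammering_path_iff walk_def)
    then show ?thesis by blast
  next
    case False
    then obtain i where i: "i + 2 < length ws" "ws ! i = ws ! (i + 2)"
      by (auto simp: nostammer_def)
    define vs where "vs = drop (i + 2) ws"
    have vs: "vs \<noteq> []" "last vs = last ws" "hd vs = ws ! i" "walk G vs"
      using i 1 by (auto simp: vs_def hd_drop_conv_nth intro: walk_drop)
    define us where "us = take i ws @ vs"
    have "walk G us \<and> hd us = hd ws"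
    proof (cases "i = 0")
      case True
      then show ?thesis using vs i by (simp add: us_def hd_conv_nth) (metis hd_conv_nth list.size(3) not_less0)
    next
      case False
      have "incident G (last (take i ws)) (ws ! i)"
        using walk_nth[of G ws "i - 1"] 1 False i by (simp add: last_take_nth)
      moreover have "take i ws \<noteq> []" "walk G (take i ws)"
        using False i 1 by (auto intro: walk_take)
      ultimately have "walk G us"
        using vs by (simp add: us_def walk_append)
      then show ?thesis using False i by (auto simp: us_def hd_append)
    qed
    moreover have "length us + 2 = length ws" "last us = last ws"
      using i vs by (auto simp: us_def vs_def)
    ultimately obtain k zs where "joins G k zs (hd ws) (last ws)" "zs = us \<or> k + 3 \<le> length us"
      using 1 by (metis less_add_same_cancel1 zero_less_numeral)
    moreover have "length zs = k + 1" using calculation by (simp add: joins_def non_stammering_path_def)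
    ultimately show ?thesis using \<open>length us + 2 = length ws\<close> by (intro exI[of _ k] exI[of _ zs]) auto
  qed
qed

section \<open>Generalized polygons\<close>

lemma polygon_rank2: "generalized_polygon n G \<Longrightarrow> rank2_geometry G"
  by (simp add: generalized_polygon_def)

lemma polygon_thick:
  "generalized_polygon n G \<Longrightarrow> x \<in> elements G \<Longrightarrow> \<exists>w. incident G x w \<and> w \<noteq> a \<and> w \<noteq> b"
  unfolding generalized_polygon_def by metis

lemma polygon_connected:
  "generalized_polygon n G \<Longrightarrow> x \<in> elements G \<Longrightarrow> y \<in> elements G \<Longrightarrow> \<exists>k\<le>n. \<exists>ys. joins G k ys x y"
  by (simp add: generalized_polygon_def)

lemma joins_walk:
  "joins G k ys x y \<longleftrightarrow> length ys = k + 1 \<and> walk G ys \<and> nostammer id ys \<and> hd ys = x \<and> last ys = y"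
  by (auto simp: joins_def non_stammering_path_iff)

lemma polygon_unique:
  assumes "generalized_polygon n G" "joins G k ys x y" "k < n" "joins G l zs x y" "l \<le> n"
  shows "zs = ys"
proof -
  have "x \<in> elements G" "y \<in> elements G"
    using assms(2) by (auto simp: joins_walk walk_def)
  then show ?thesis using assms unfolding generalized_polygon_def by blast
qed

lemma short_path_unique:
  assumes "generalized_polygon n G" "joins G k ys x y" "k < n"
    and "walk G ws" "hd ws = x" "last ws = y" "length ws \<le> n + 1"
  shows "ws = ys \<or> k + 3 \<le> length ws"
proof -
  obtain l zs where zs: "joins G l zs x y" "zs = ws \<or> l + 3 \<le> length ws"
    using walk_reduce assms by metis
  then have "l \<le> n" using assms(7) by (auto simp: joins_walk)
  then have "zs = ys" using polygon_unique assms zs by metis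
  moreover have "l = k" using zs(1) assms(2) calculation by (simp add: joins_walk)
  ultimately show ?thesis using zs by blast
qed

text \<open>Elements joined by a path of length \<open>n\<close> have distance \<open>n\<close>: a walk that stammers or is too short
  would reduce to a second, shorter path between them.\<close>

lemma opposite_walk:
  assumes "generalized_polygon n G" "joins G n ys x y"
    and "walk G ws" "hd ws = x" "last ws = y" "length ws \<le> n + 1"
  shows "joins G n ws x y"
proof -
  obtain l zs where zs: "joins G l zs x y" "zs = ws \<or> l + 3 \<le> length ws"
    using walk_reduce assms by metis
  have "l \<le> n" using zs assms(6) by (auto simp: joins_walk)
  moreover have "\<not> l < n"
    using polygon_unique[OF assms(1) zs(1) _ assms(2)] zs(1) assms(2) by (auto simp: joins_walk)
  ultimately have "l = n" by simp
  then show ?thesis using zs assms(6) by auto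
qed

lemma walk_parity:
  assumes "rank2_geometry G" "walk G ws"
  shows "last ws \<in> points G \<longleftrightarrow> (hd ws \<in> points G \<longleftrightarrow> odd (length ws))"
  using assms(2)
proof (induction ws)
  case (Cons w ws)
  show ?case
  proof (cases "ws = []")
    case False
    then show ?thesis using Cons incident_points[OF assms(1), of w "hd ws"] by (auto simp: walk_Cons)
  qed auto
qed (auto simp: walk_def)

text \<open>The projection of \<open>u\<close> to \<open>a\<close>, which is the perspectivity between the opposite elements \<open>a\<close> and
  \<open>b\<close>. Parity forces \<open>u\<close> to be at distance \<open>n - 1\<close> from \<open>a\<close>.\<close>

lemma opposite_path_via:
  assumes G: "generalized_polygon n G" and ys: "joins G n ys a b" and u: "incident G u b"
  shows "\<exists>zs. joins G n zs a b \<and> zs ! (n - 1) = u"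
proof -
  have r: "rank2_geometry G" using G by (rule polygon_rank2)
  have el: "a \<in> elements G" "b \<in> elements G" "u \<in> elements G"
    using ys incident_elements[OF r u] by (auto simp: joins_walk walk_def)
  obtain k zs where zs: "k \<le> n" "joins G k zs a u" using polygon_connected[OF G] el by blast
  have "k \<noteq> n"
    using walk_parity[OF r, of ys] walk_parity[OF r, of zs] incident_points[OF r u] ys zs
    by (auto simp: joins_walk)
  moreover have "zs \<noteq> []" using zs by (auto simp: joins_walk)
  moreover have "walk G (zs @ [b])"
    using zs u el \<open>zs \<noteq> []\<close> by (auto simp: joins_walk walk_append) (auto simp: walk_def)
  ultimately have j: "joins G n (zs @ [b]) a b"
    using zs by (intro opposite_walk[OF G ys]) (auto simp: joins_walk)
  then have "length zs = n" by (simp add: joins_walk)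
  then have "(zs @ [b]) ! (n - 1) = u"
    using \<open>zs \<noteq> []\<close> zs by (auto simp: joins_walk nth_append last_conv_nth)
  with j show ?thesis by blast
qed

lemma extend_path:
  assumes G: "generalized_polygon n G" and "joins G k ys a b" "k \<le> m"
  shows "\<exists>zs c. joins G m (ys @ zs) a c"
  using assms(3)
proof (induction m rule: dec_induct)
  case base
  then show ?case using assms(2) by (intro exI[of _ "[]"] exI[of _ b]) simp
next
  case (step m)
  then obtain zs c where zs: "joins G m (ys @ zs) a c" by blast
  define ws where "ws = ys @ zs"
  have ws: "length ws = m + 1" "walk G ws" "nostammer id ws" "hd ws = a" "last ws = c" "ws \<noteq> []"
    using zs by (auto simp: ws_def joins_walk)
  have c: "c \<in> elements G" using ws by (auto simp: walk_def)
  obtain d where d: "incident G c d" "d \<noteq> ws ! (m - 1)" using polygon_thick[OF G c] by blast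
  have "walk G (ws @ [d])"
    using ws d incident_elements[OF polygon_rank2[OF G] d(1)]
    by (auto simp: walk_append) (auto simp: walk_def)
  moreover have "nostammer id (ws @ [d])"
  proof -
    have "(ws @ [d]) ! i \<noteq> (ws @ [d]) ! (i + 2)" if "i + 2 < m + 2" for i
    proof (cases "i + 2 = m + 1")
      case True
      then have "i = m - 1" "i < m" by auto
      then show ?thesis using True d ws by (auto simp: nth_append)
    next
      case False
      then show ?thesis using that ws by (auto simp: nth_append nostammer_def)
    qed
    then show ?thesis using ws by (auto simp: nostammer_def)
  qed
  ultimately have "joins G (Suc m) (ys @ (zs @ [d])) a d"
    using ws by (auto simp: joins_walk ws_def[symmetric] simp flip: append_assoc)
  then show ?case by blast
qed

definition opposite :: "nat \<Rightarrow> 'a geometry \<Rightarrow> 'a \<Rightarrow> 'a \<Rightarrow> bool" where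
  "opposite n G a b \<longleftrightarrow> (\<exists>ys. joins G n ys a b)"

text \<open>Prolonging the path from \<open>a\<close> to \<open>b\<close> beyond \<open>b\<close> up to length \<open>n\<close> ends in an element opposite \<open>a\<close>
  but too close to \<open>b\<close>.\<close>

lemma opposite_separates:
  assumes G: "generalized_polygon n G" and "a \<in> elements G" "b \<in> elements G" "a \<noteq> b"
  shows "\<exists>c\<in>elements G. opposite n G a c \<and> \<not> opposite n G b c"
proof -
  obtain k ys where ys: "k \<le> n" "joins G k ys a b" using polygon_connected[OF G] assms by blast
  then obtain zs c where zs: "joins G n (ys @ zs) a c" using extend_path[OF G] by blast
  have k: "k > 0"
  proof (rule ccontr)
    assume "\<not> k > 0"
    then have "length ys = 1" using ys by (simp add: joins_walk)
    then obtain x where "ys = [x]" by (auto simp: length_Suc_conv)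
    then show False using ys assms by (auto simp: joins_walk)
  qed
  have c: "c \<in> elements G" using zs walk_ends by (auto simp: joins_walk)
  have "\<not> opposite n G b c"
  proof
    assume "opposite n G b c"
    then obtain vs where vs: "joins G n vs b c" by (auto simp: opposite_def)
    define ws where "ws = drop k (ys @ zs)"
    have "length ws = n - k + 1" "walk G ws" "last ws = c"
      using zs ys by (auto simp: ws_def joins_walk intro: walk_drop simp del: drop_append)
    moreover have nz: "ys \<noteq> []" using ys by (auto simp: joins_walk)
    moreover have "hd ws = b"
      using ys nz by (auto simp: ws_def joins_walk hd_drop_conv_nth nth_append last_conv_nth simp del: drop_append)
    ultimately have "joins G n ws b c" using opposite_walk[OF G vs] by auto
    then show False using \<open>length ws = n - k + 1\<close> k ys by (auto simp: joins_walk)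
  qed
  then show ?thesis using zs c by (auto simp: opposite_def)
qed

section \<open>Epimorphisms\<close>

lemma epi_surj: "epimorphism G G' \<phi> \<Longrightarrow> y \<in> elements G' \<Longrightarrow> \<exists>x\<in>elements G. \<phi> x = y"
  unfolding epimorphism_def by (metis imageE)

lemma epi_walk: "epimorphism G G' \<phi> \<Longrightarrow> walk G ws \<Longrightarrow> walk G' (map \<phi> ws)"
  unfolding walk_def successively_map
  by (auto simp: epimorphism_def image_subset_iff elim!: successively_mono)

lemma epi_walk_joins:
  assumes "epimorphism G G' \<phi>" "walk G ws" "nostammer \<phi> ws" "length ws = k + 1"
  shows "joins G' k (map \<phi> ws) (\<phi> (hd ws)) (\<phi> (last ws))"
  using epi_walk[OF assms(1,2)] assms(2-4)
  by (auto simp: joins_walk nostammer_map walk_def hd_map last_map)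

text \<open>Prolong \<open>(\<phi> x, y')\<close> to a path of length \<open>n - 1\<close> with end \<open>c\<close>, and join \<open>x\<close> in \<open>G\<close> to any preimage of
  \<open>c\<close>. The image of the joining path is a walk of length at most \<open>n\<close> with the same ends, so it is the
  given path, and its second element is \<open>y'\<close>.\<close>

lemma epi_local_surj:
  assumes n: "n \<ge> 3" and G: "generalized_polygon n G" and G': "generalized_polygon n G'"
    and e: "epimorphism G G' \<phi>" and x: "x \<in> elements G" and y: "incident G' (\<phi> x) y'"
  shows "\<exists>y. incident G x y \<and> \<phi> y = y'"
proof -
  have "joins G' 1 [\<phi> x, y'] (\<phi> x) y'"
    using y incident_elements[OF polygon_rank2[OF G'] y]
    by (auto simp: joins_walk walk_def nostammer_def)
  moreover have "1 \<le> n - 1" using n by simp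
  ultimately obtain zs c where zs: "joins G' (n - 1) ([\<phi> x, y'] @ zs) (\<phi> x) c"
    using extend_path[OF G'] by blast
  then have "c \<in> elements G'" by (auto simp: joins_walk walk_def split: if_splits)
  then obtain w where w: "w \<in> elements G" "\<phi> w = c" using epi_surj[OF e] by blast
  obtain k ws where ws: "k \<le> n" "joins G k ws x w" using polygon_connected[OF G] x w by blast
  then have nz: "ws \<noteq> []" by (auto simp: joins_walk)
  have "map \<phi> ws = [\<phi> x, y'] @ zs \<or> n - 1 + 3 \<le> length (map \<phi> ws)"
    using ws w n nz epi_walk[OF e, of ws]
    by (intro short_path_unique[OF G' zs]) (auto simp: joins_walk hd_map last_map)
  then have m: "map \<phi> ws = [\<phi> x, y'] @ zs" using ws n by (auto simp: joins_walk)
  then obtain a b us where "ws = a # b # us" by (auto simp: map_eq_Cons_conv)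
  then have "incident G x b" "\<phi> b = y'" using ws m by (auto simp: joins_walk walk_def)
  then show ?thesis by blast
qed

lemma epi_lift_walk:
  assumes n: "n \<ge> 3" and G: "generalized_polygon n G" and G': "generalized_polygon n G'"
    and e: "epimorphism G G' \<phi>" and w: "walk G' ws'"
  shows "\<exists>ws. walk G ws \<and> map \<phi> ws = ws'"
  using w
proof (induction ws')
  case (Cons x' ws')
  show ?case
  proof (cases "ws' = []")
    case True
    then have "x' \<in> elements G'" using Cons by (simp add: walk_def)
    then obtain x where "x \<in> elements G" "\<phi> x = x'" using epi_surj[OF e] by blast
    then show ?thesis using True by (intro exI[of _ "[x]"]) (auto simp: walk_def)
  next
    case False
    then obtain ws where ws: "walk G ws" "map \<phi> ws = ws'" using Cons by (auto simp: walk_Cons)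
    then have nz: "ws \<noteq> []" using False by auto
    have "incident G' (\<phi> (hd ws)) x'"
      using Cons False ws nz by (auto simp: walk_Cons hd_map intro: incident_sym)
    moreover have "hd ws \<in> elements G" using ws nz by (auto simp: walk_def)
    ultimately obtain x where x: "incident G (hd ws) x" "\<phi> x = x'"
      using epi_local_surj[OF n G G' e] by blast
    then have "walk G (x # ws)"
      using ws nz incident_elements[OF polygon_rank2[OF G] x(1)]
      by (auto simp: walk_Cons intro: incident_sym)
    then show ?thesis using ws x by (intro exI[of _ "x # ws"]) auto
  qed
qed (auto simp: walk_def)

lemma epi_second_eqD:
  assumes n: "n \<ge> 3" and G': "generalized_polygon n G'" and e: "epimorphism G G' \<phi>"
    and "walk G us" "nostammer \<phi> us" "length us = n + 1"
    and "walk G vs" "nostammer \<phi> vs" "length vs = n + 1"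
    and "hd us = hd vs" "\<phi> (us ! (n - 1)) = \<phi> (vs ! (n - 1))"
  shows "\<phi> (us ! 1) = \<phi> (vs ! 1)"
proof -
  have j: "joins G' (n - 1) (map \<phi> (take n ws)) (\<phi> (hd ws)) (\<phi> (ws ! (n - 1)))"
    if "walk G ws" "nostammer \<phi> ws" "length ws = n + 1" for ws
  proof -
    have "last (take n ws) = ws ! (n - 1)" "hd (take n ws) = hd ws"
      using that n by (auto simp: last_take_nth)
    then show ?thesis
      using epi_walk_joins[OF e, of "take n ws" "n - 1"] that n walk_take[of G ws n]
        nostammer_take[of \<phi> ws n] by simp
  qed
  have "map \<phi> (take n us) = map \<phi> (take n vs)"
    using j[of vs] j[of us] assms n by (intro polygon_unique[OF G', of "n - 1" _ _ _ "n - 1"]) auto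
  then have "map \<phi> (take n us) ! 1 = map \<phi> (take n vs) ! 1" by simp
  then show ?thesis using n assms by simp
qed

text \<open>Epimorphisms commute with perspectivities: between elements with opposite images, the images
  of the second elements of two paths coincide exactly if those of the last but one do. Hence the
  kernel near one end determines the kernel near the other.\<close>

lemma epi_second_eq_iff:
  assumes n: "n \<ge> 3" and G': "generalized_polygon n G'" and e: "epimorphism G G' \<phi>"
    and us: "walk G us" "nostammer \<phi> us" "length us = n + 1"
    and vs: "walk G vs" "nostammer \<phi> vs" "length vs = n + 1"
    and "hd us = hd vs" "last us = last vs"
  shows "\<phi> (us ! 1) = \<phi> (vs ! 1) \<longleftrightarrow> \<phi> (us ! (n - 1)) = \<phi> (vs ! (n - 1))"
proof
  assume *: "\<phi> (us ! 1) = \<phi> (vs ! 1)"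
  have "rev us ! (n - 1) = us ! 1" "rev us ! 1 = us ! (n - 1)"
    "rev vs ! (n - 1) = vs ! 1" "rev vs ! 1 = vs ! (n - 1)"
    using n us vs by (auto simp: rev_nth Suc_diff_Suc)
  then show "\<phi> (us ! (n - 1)) = \<phi> (vs ! (n - 1))"
    using epi_second_eqD[OF n G' e, of "rev us" "rev vs"] assms *
    by (auto simp: walk_rev nostammer_rev hd_rev)
qed (use epi_second_eqD[OF n G' e us vs] assms in auto)

lemma epi_opposite_walk:
  assumes G': "generalized_polygon n G'" and e: "epimorphism G G' \<phi>"
    and "opposite n G' (\<phi> a) (\<phi> b)" "walk G ws" "hd ws = a" "last ws = b" "length ws \<le> n + 1"
  shows "length ws = n + 1 \<and> nostammer \<phi> ws"
proof -
  obtain ys where ys: "joins G' n ys (\<phi> a) (\<phi> b)" using assms by (auto simp: opposite_def)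
  have "joins G' n (map \<phi> ws) (\<phi> a) (\<phi> b)"
    using assms epi_walk[OF e, of ws]
    by (intro opposite_walk[OF G' ys]) (auto simp: hd_map last_map walk_def)
  then show ?thesis by (auto simp: joins_walk nostammer_map)
qed

text \<open>An element is determined by the elements opposite to it, so the relation of having opposite
  images determines the kernel of an epimorphism.\<close>

lemma epi_kernel_le:
  assumes G': "generalized_polygon n G'" and p: "epimorphism G G' \<phi>" "epimorphism G G' \<psi>"
    and opp: "\<And>u v. u \<in> elements G \<Longrightarrow> v \<in> elements G \<Longrightarrow>
      opposite n G' (\<phi> u) (\<phi> v) \<longleftrightarrow> opposite n G' (\<psi> u) (\<psi> v)"
    and uv: "u \<in> elements G" "v \<in> elements G" "\<phi> u = \<phi> v"
  shows "\<psi> u = \<psi> v"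
proof (rule ccontr)
  assume "\<psi> u \<noteq> \<psi> v"
  moreover have "\<psi> ` elements G = elements G'" using p by (auto simp: epimorphism_def)
  ultimately obtain c where c: "c \<in> elements G'" "opposite n G' (\<psi> u) c" "\<not> opposite n G' (\<psi> v) c"
    using opposite_separates[OF G', of "\<psi> u" "\<psi> v"] uv by blast
  then obtain w where "w \<in> elements G" "\<psi> w = c" using epi_surj[OF p(2)] by blast
  then show False using c opp uv by metis
qed

section \<open>Comparing two epimorphisms\<close>

locale two_epimorphisms =
  fixes n :: nat and G :: "'a geometry" and G' :: "'b geometry" and \<phi> \<psi> :: "'a \<Rightarrow> 'b"
  assumes n: "n \<ge> 3" and G: "generalized_polygon n G" and G': "generalized_polygon n G'"
    and phi: "epimorphism G G' \<phi>" and psi: "epimorphism G G' \<psi>"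
begin

definition agree :: "'a \<Rightarrow> bool" where
  "agree x \<longleftrightarrow> (\<forall>u v. incident G x u \<longrightarrow> incident G x v \<longrightarrow> (\<phi> u = \<phi> v \<longleftrightarrow> \<psi> u = \<psi> v))"

text \<open>A root is visible exactly if its ends have opposite images under both maps.\<close>

definition visible :: "'a list \<Rightarrow> bool" where
  "visible ws \<longleftrightarrow> walk G ws \<and> nostammer \<phi> ws \<and> nostammer \<psi> ws"

text \<open>A closed path of length \<open>2 * n\<close>, written with its base element at both ends; the last two
  conditions say that neither image stammers there.\<close>

definition apartment :: "'a list \<Rightarrow> bool" where
  "apartment ws \<longleftrightarrow> visible ws \<and> length ws = 2 * n + 1 \<and> hd ws = last ws \<and>
     \<phi> (ws ! 1) \<noteq> \<phi> (ws ! (2 * n - 1)) \<and> \<psi> (ws ! 1) \<noteq> \<psi> (ws ! (2 * n - 1))"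

lemma visible_rev: "visible ws \<Longrightarrow> visible (rev ws)"
  by (simp add: visible_def walk_rev nostammer_rev)

lemma visible_take: "visible ws \<Longrightarrow> k > 0 \<Longrightarrow> visible (take k ws)"
  by (simp add: visible_def walk_take nostammer_take)

lemma visible_drop: "visible ws \<Longrightarrow> k < length ws \<Longrightarrow> visible (drop k ws)"
  by (simp add: visible_def walk_drop nostammer_drop)

lemma visible_joins:
  assumes "visible ws" "length ws = n + 1"
  shows "joins G n ws (hd ws) (last ws)"
  using assms by (auto simp: visible_def joins_walk nostammer_def)

lemma visible_opposite:
  assumes "visible ws" "length ws = n + 1"
    and "walk G zs" "hd zs = hd ws" "last zs = last ws" "length zs \<le> n + 1"
  shows "visible zs"
proof -
  have "opposite n G' (\<phi> (hd ws)) (\<phi> (last ws))" "opposite n G' (\<psi> (hd ws)) (\<psi> (last ws))"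
    using epi_walk_joins[OF phi, of ws] epi_walk_joins[OF psi, of ws] assms
    by (auto simp: opposite_def visible_def)
  then show ?thesis
    using epi_opposite_walk[OF G' phi, of _ _ zs] epi_opposite_walk[OF G' psi, of _ _ zs] assms
    by (auto simp: visible_def)
qed

lemma visible_via:
  assumes "visible ws" "length ws = n + 1" "incident G (last ws) u"
  obtains zs where "visible zs" "length zs = n + 1" "hd zs = hd ws" "last zs = last ws"
    "zs ! (n - 1) = u"
proof -
  obtain zs where zs: "joins G n zs (hd ws) (last ws)" "zs ! (n - 1) = u"
    using opposite_path_via[OF G visible_joins[OF assms(1,2)]] assms(3) incident_sym by metis
  then show thesis
    using that[of zs] visible_opposite[OF assms(1,2), of zs] by (auto simp: joins_walk)
qed

lemma agree_opposite:
  assumes ws: "visible ws" "length ws = n + 1" and agree: "agree (hd ws)"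
  shows "agree (last ws)"
  unfolding agree_def
proof (intro allI impI)
  fix u v assume u: "incident G (last ws) u" and v: "incident G (last ws) v"
  obtain us where us: "visible us" "length us = n + 1" "hd us = hd ws" "last us = last ws"
    "us ! (n - 1) = u" using visible_via[OF ws u] .
  obtain vs where vs: "visible vs" "length vs = n + 1" "hd vs = hd ws" "last vs = last ws"
    "vs ! (n - 1) = v" using visible_via[OF ws v] .
  have "incident G (hd ws) (us ! 1)" "incident G (hd ws) (vs ! 1)"
    using us vs walk_nth[of G us 0] walk_nth[of G vs 0] n
    by (auto simp: visible_def walk_def hd_conv_nth)
  then have "\<phi> (us ! 1) = \<phi> (vs ! 1) \<longleftrightarrow> \<psi> (us ! 1) = \<psi> (vs ! 1)"
    using agree by (auto simp: agree_def)
  then show "\<phi> u = \<phi> v \<longleftrightarrow> \<psi> u = \<psi> v"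
    using epi_second_eq_iff[OF n G' phi, of us vs] epi_second_eq_iff[OF n G' psi, of us vs] us vs
    by (auto simp: visible_def)
qed

text \<open>Projecting \<open>q\<close> to the other end of the root closes the path. It does not stammer there in the
  images, since perspectivities are injective and \<open>q\<close> and \<open>xs ! 1\<close> have different images.\<close>

lemma apartment_through:
  assumes xs: "visible xs" "length xs = n + 1" and q: "incident G (hd xs) q"
    and neq: "\<phi> q \<noteq> \<phi> (xs ! 1)" "\<psi> q \<noteq> \<psi> (xs ! 1)"
  obtains ws where "apartment ws" "take (n + 1) ws = xs" "ws ! (2 * n - 1) = q"
proof -
  have nz: "xs \<noteq> []" using xs by auto
  obtain zs where zs: "visible zs" "length zs = n + 1" "hd zs = last xs" "last zs = hd xs"
    "zs ! (n - 1) = q"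
    using visible_via[of "rev xs" q] xs q nz by (auto simp: visible_rev hd_rev last_rev)
  have r: "rev xs ! 1 = xs ! (n - 1)" "rev xs ! (n - 1) = xs ! 1"
    using xs n by (auto simp: rev_nth Suc_diff_Suc)
  define ws where "ws = xs @ tl zs"
  have zs': "last xs # tl zs = zs" "tl zs \<noteq> []" "hd (tl zs) = zs ! 1"
    using zs n by (cases zs; cases "tl zs"; auto)+
  have b: "butlast xs = take n xs" using xs by (simp add: butlast_conv_take)
  have xs': "butlast xs @ [last xs] = xs" "last (butlast xs) = xs ! (n - 1)"
    using nz n xs by (simp, simp add: b last_take_nth)
  have "ws = (butlast xs @ [last xs]) @ tl zs" unfolding ws_def xs'(1) ..
  then have ws': "ws = butlast xs @ last xs # tl zs" by simp
  have glue: "nostammer f ws"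
    if "epimorphism G G' f" "nostammer f xs" "nostammer f zs" "f q \<noteq> f (xs ! 1)" for f
  proof -
    have "f (rev xs ! 1) \<noteq> f (zs ! 1)"
      using epi_second_eq_iff[OF n G' that(1), of "rev xs" zs] that xs zs r nz
      by (auto simp: visible_def walk_rev nostammer_rev hd_rev last_rev)
    then have "f (last (butlast xs)) \<noteq> f (hd (tl zs))" by (simp only: r xs'(2) zs'(3) not_False_eq_True)
    moreover have "nostammer f (butlast xs @ [last xs])" unfolding xs'(1) by (rule that(2))
    moreover have "nostammer f (last xs # tl zs)" unfolding zs'(1) by (rule that(3))
    ultimately show ?thesis unfolding ws' by (metis nostammer_glue)
  qed
  have "zs ! 0 = last xs" using zs(2,3) by (cases zs) auto
  then have "incident G (last xs) (hd (tl zs))"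
    using zs(1,2) zs'(3) walk_nth[of G zs 0] n by (simp add: visible_def)
  moreover have "walk G (tl zs)"
    using zs n walk_drop[of G zs 1] by (auto simp: visible_def drop_Suc)
  ultimately have "visible ws"
    using glue[OF phi] glue[OF psi] xs zs neq zs' nz unfolding visible_def
    by (auto simp: ws_def walk_append)
  moreover have "length ws = 2 * n + 1" "take (n + 1) ws = xs" "hd ws = hd xs"
    using xs zs nz by (auto simp: ws_def)
  moreover have "last ws = hd xs"
    using zs zs' by (simp add: ws_def) (metis last.simps)
  moreover have "ws ! (2 * n - 1) = q"
  proof -
    have "zs ! (n - 1) = tl zs ! (n - 2)"
      using zs n by (subst nth_tl) (auto simp: numeral_2_eq_2 Suc_diff_Suc)
    then show ?thesis using zs n xs by (auto simp: ws_def nth_append numeral_2_eq_2)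
  qed
  moreover have "ws ! 1 = xs ! 1" using xs n by (simp add: ws_def nth_append)
  ultimately show thesis using that[of ws] neq by (auto simp: apartment_def)
qed

lemma apartment_opposite:
  assumes ws: "visible ws" "length ws = 2 * n + 1" and i: "i \<le> n"
  shows "agree (ws ! i) \<longleftrightarrow> agree (ws ! (n + i))"
proof -
  define xs where "xs = take (n + 1) (drop i ws)"
  have xs: "visible xs" "length xs = n + 1"
    using ws i n by (auto simp: xs_def intro!: visible_take visible_drop)
  then have nz: "xs \<noteq> []" by auto
  have "hd xs = ws ! i" "last xs = ws ! (n + i)"
    using i ws nz by (simp_all add: xs_def hd_drop_conv_nth last_take_nth add.commute)
  then show ?thesis
    using agree_opposite[OF xs] agree_opposite[of "rev xs"] xs nz
    by (auto simp: visible_rev hd_rev last_rev)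
qed

definition agreeing_apartment :: "'a list \<Rightarrow> bool" where
  "agreeing_apartment ws \<longleftrightarrow> apartment ws \<and> (\<forall>x\<in>set ws. agree x)"

text \<open>Half an apartment is enough, as the other half consists of elements opposite to it.\<close>

lemma agreeing_apartmentI:
  assumes ws: "apartment ws" and agree: "\<And>x. x \<in> set (take (n + 1) ws) \<Longrightarrow> agree x"
  shows "agreeing_apartment ws"
proof -
  have ws': "visible ws" "length ws = 2 * n + 1" using ws by (auto simp: apartment_def)
  have less: "agree (ws ! i)" if "i \<le> n" for i
    using that ws' by (intro agree) (auto simp: in_set_conv_nth intro!: exI[of _ i])
  have "agree (ws ! i)" if "i < 2 * n + 1" for i
  proof (cases "i \<le> n")
    case False
    then show ?thesis using apartment_opposite[OF ws', of "i - n"] less[of "i - n"] that by auto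
  qed (rule less)
  then show ?thesis using ws ws' by (auto simp: agreeing_apartment_def in_set_conv_nth)
qed

lemma agreeing_apartment_rev:
  assumes "agreeing_apartment ws" shows "agreeing_apartment (rev ws)"
proof -
  have ws: "length ws = 2 * n + 1" "ws \<noteq> []"
    using assms by (auto simp: agreeing_apartment_def apartment_def)
  then have "rev ws ! 1 = ws ! (2 * n - 1)" "rev ws ! (2 * n - 1) = ws ! 1"
    using n by (auto simp: rev_nth Suc_diff_Suc)
  then show ?thesis
    using assms ws by (auto simp: agreeing_apartment_def apartment_def visible_rev hd_rev last_rev)
qed

lemma agreeing_apartment_rotate:
  assumes "agreeing_apartment ws" shows "agreeing_apartment (tl ws @ [ws ! 1])"
proof -
  have ws: "visible ws" "length ws = 2 * n + 1" "hd ws = last ws"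
    "\<phi> (ws ! 1) \<noteq> \<phi> (ws ! (2 * n - 1))" "\<psi> (ws ! 1) \<noteq> \<psi> (ws ! (2 * n - 1))"
    and agree: "\<forall>x\<in>set ws. agree x"
    using assms by (auto simp: agreeing_apartment_def apartment_def)
  define a q r where "a = hd ws" and "q = ws ! 1" and "r = butlast (tl (tl ws))"
  have nz: "tl (tl ws) \<noteq> []" using ws n by (cases ws; cases "tl ws"; auto)
  have "last (tl (tl ws)) = a"
    using nz ws(3) by (cases ws; cases "tl ws"; auto simp: a_def)
  then have "tl (tl ws) = r @ [a]" using nz append_butlast_last_id[of "tl (tl ws)"] by (simp add: r_def)
  then have e: "ws = a # q # r @ [a]"
    using ws n by (cases ws; cases "tl ws"; auto simp: a_def q_def)
  have lr: "length r = 2 * n - 2" "r \<noteq> []" using ws n unfolding e by auto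
  have ends: "ws ! (2 * n - 1) = last r" "ws ! 2 = hd r"
    using lr n unfolding e by (auto simp: nth_append nth_Cons' last_conv_nth hd_conv_nth numeral_3_eq_3)
  have v: "visible (q # r @ [a])" using visible_drop[OF ws(1), of 1] e by simp
  have "incident G a q" using ws e walk_nth[of G ws 0] n by (auto simp: visible_def)
  have glue: "nostammer f ((q # r) @ a # [q])" if "nostammer f (q # r @ [a])" "f q \<noteq> f (last r)" for f
  proof (rule nostammer_glue)
    show "nostammer f [a, q]" by (simp add: nostammer_def)
  qed (use that lr in simp_all)
  have "walk G ((q # r @ [a]) @ [q])"
    using v \<open>incident G a q\<close> by (subst walk_append) (auto simp: visible_def walk_def)
  then have "visible (q # r @ [a, q])"
    using v glue[of \<phi>] glue[of \<psi>] ws(4,5) ends by (simp add: visible_def q_def)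
  moreover have "f (hd r) \<noteq> f a" if "nostammer f ws" for f
  proof -
    have "f (ws ! 0) \<noteq> f (ws ! (0 + 2))" using that ws n unfolding nostammer_def by auto
    then show ?thesis using ends(2) e by auto
  qed
  moreover have "(q # r @ [a, q]) ! (2 * n - 1) = a" "(q # r @ [a, q]) ! 1 = hd r"
    using lr n by (auto simp: nth_append nth_Cons' hd_conv_nth)
  ultimately have "apartment (q # r @ [a, q])"
    using ws lr n by (auto simp: apartment_def visible_def)
  moreover have "tl ws @ [ws ! 1] = q # r @ [a, q]" unfolding e by simp
  ultimately show ?thesis using agree e by (auto simp: agreeing_apartment_def)
qed

text \<open>Agreement at the base element turns the hypothesis on \<open>\<phi> q\<close> into the same one on \<open>\<psi> q\<close>, so
  there is an apartment through \<open>q\<close> that contains the first half of the given one.\<close>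

lemma agreeing_apartment_move_aux:
  assumes ws: "agreeing_apartment ws" and q: "incident G (hd ws) q" and neq: "\<phi> q \<noteq> \<phi> (ws ! 1)"
  shows "\<exists>ws'. agreeing_apartment ws' \<and> hd ws' = q"
proof -
  have ws': "visible ws" "length ws = 2 * n + 1" "\<forall>x\<in>set ws. agree x" "ws \<noteq> []"
    using ws by (auto simp: agreeing_apartment_def apartment_def)
  have "agree (hd ws)" using ws' by auto
  moreover have "incident G (hd ws) (ws ! 1)"
    using walk_nth[of G ws 0] ws' n by (auto simp: visible_def hd_conv_nth)
  ultimately have neq': "\<psi> q \<noteq> \<psi> (ws ! 1)" using q neq by (auto simp: agree_def)
  define xs where "xs = take (n + 1) ws"
  have xs: "visible xs" "length xs = n + 1" "hd xs = hd ws" "xs ! 1 = ws ! 1"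
    using ws' n by (auto simp: xs_def intro: visible_take)
  obtain vs where vs: "apartment vs" "take (n + 1) vs = xs" "vs ! (2 * n - 1) = q"
    using apartment_through[OF xs(1,2), of q] q neq neq' xs by auto
  have "agreeing_apartment vs"
    using vs ws' by (intro agreeing_apartmentI) (auto simp: xs_def dest: in_set_takeD)
  then have "agreeing_apartment (tl (rev vs) @ [rev vs ! 1])"
    by (intro agreeing_apartment_rotate agreeing_apartment_rev)
  moreover have "hd (tl (rev vs) @ [rev vs ! 1]) = q"
  proof -
    have l: "length vs = 2 * n + 1" using vs by (simp add: apartment_def)
    then have "tl (rev vs) \<noteq> []" using n by (cases "rev vs"; cases "tl (rev vs)"; auto)
    then have "hd (tl (rev vs)) = rev vs ! 1" by (cases "rev vs"; cases "tl (rev vs)"; auto)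
    also have "\<dots> = q" using l vs(3) n by (auto simp: rev_nth)
    finally show ?thesis using \<open>tl (rev vs) \<noteq> []\<close> by simp
  qed
  ultimately show ?thesis by blast
qed

text \<open>Since the two neighbours of the base element in an apartment have different images, the image of
  \<open>q\<close> is different from one of them; reversing the apartment exchanges them.\<close>

lemma agreeing_apartment_move:
  assumes ws: "agreeing_apartment ws" and q: "incident G (hd ws) q"
  shows "\<exists>ws'. agreeing_apartment ws' \<and> hd ws' = q"
proof (cases "\<phi> q = \<phi> (ws ! 1)")
  case True
  have ws': "length ws = 2 * n + 1" "hd ws = last ws" "\<phi> (ws ! 1) \<noteq> \<phi> (ws ! (2 * n - 1))"
    using ws by (auto simp: agreeing_apartment_def apartment_def)
  have "rev ws ! 1 = ws ! (2 * n - 1)" "hd (rev ws) = hd ws"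
    using ws' n by (auto simp: rev_nth hd_rev)
  then show ?thesis using agreeing_apartment_move_aux[OF agreeing_apartment_rev[OF ws], of q] q True ws' by simp
qed (use agreeing_apartment_move_aux[OF assms] in blast)

lemma agreeing_apartment_connected:
  assumes "walk G us" "agreeing_apartment ws" "hd ws = hd us"
  shows "\<exists>ws'. agreeing_apartment ws' \<and> hd ws' = last us"
  using assms
proof (induction us arbitrary: ws)
  case (Cons u us)
  show ?case
  proof (cases "us = []")
    case False
    then have "walk G us" "incident G (hd ws) (hd us)" using Cons by (auto simp: walk_Cons)
    then show ?thesis using Cons False agreeing_apartment_move[OF Cons.prems(2)] by fastforce
  qed (use Cons in auto)
qed (auto simp: walk_def)

lemma all_agree:
  assumes ws: "agreeing_apartment ws" and x: "x \<in> elements G"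
  shows "agree x"
proof -
  have "visible ws" using ws by (auto simp: agreeing_apartment_def apartment_def)
  then have "hd ws \<in> elements G" using walk_ends by (auto simp: visible_def)
  then obtain us k where "joins G k us (hd ws) x" using polygon_connected[OF G _ x] by blast
  then obtain ws' where "agreeing_apartment ws'" "hd ws' = x"
    using agreeing_apartment_connected[OF _ ws, of us] by (auto simp: joins_walk)
  then show ?thesis by (auto simp: agreeing_apartment_def apartment_def visible_def walk_def)
qed

text \<open>Opposition of images depends only on whether paths of \<open>G\<close> stammer in the image, a condition
  that involves only elements incident with a common element.\<close>

lemma opposite_iff_nostammer:
  assumes "epimorphism G G' f" "u \<in> elements G" "v \<in> elements G"
  shows "opposite n G' (f u) (f v) \<longleftrightarrow> (\<exists>ws. joins G n ws u v \<and> nostammer f ws)"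
proof
  assume o: "opposite n G' (f u) (f v)"
  obtain k ws where ws: "k \<le> n" "joins G k ws u v" using polygon_connected[OF G] assms by blast
  then have "length ws = n + 1 \<and> nostammer f ws"
    using epi_opposite_walk[OF G' assms(1) o, of ws] by (auto simp: joins_walk)
  then show "\<exists>ws. joins G n ws u v \<and> nostammer f ws" using ws by (auto simp: joins_walk)
next
  assume "\<exists>ws. joins G n ws u v \<and> nostammer f ws"
  then obtain ws where "joins G n ws u v" "nostammer f ws" by blast
  then have "joins G' n (map f ws) (f u) (f v)"
    using epi_walk_joins[OF assms(1), of ws n] by (auto simp: joins_walk)
  then show "opposite n G' (f u) (f v)" by (auto simp: opposite_def)
qed

lemma kernels_agree:
  assumes ws: "agreeing_apartment ws" and uv: "u \<in> elements G" "v \<in> elements G"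
  shows "\<phi> u = \<phi> v \<longleftrightarrow> \<psi> u = \<psi> v"
proof -
  have "nostammer \<phi> us \<longleftrightarrow> nostammer \<psi> us" if us: "walk G us" for us
  proof -
    have "\<phi> (us ! i) = \<phi> (us ! (i + 2)) \<longleftrightarrow> \<psi> (us ! i) = \<psi> (us ! (i + 2))"
      if "i + 2 < length us" for i
    proof -
      have "incident G (us ! (i + 1)) (us ! i)" "incident G (us ! (i + 1)) (us ! (i + 2))"
        using walk_nth[OF us, of i] walk_nth[OF us, of "i + 1"] that by (auto intro: incident_sym)
      moreover have "us ! (i + 1) \<in> set us" using that by (intro nth_mem) simp
      then have "agree (us ! (i + 1))" using all_agree[OF ws] us unfolding walk_def by blast
      ultimately show ?thesis by (auto simp: agree_def)
    qed
    then show ?thesis by (auto simp: nostammer_def)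
  qed
  then have opp: "opposite n G' (\<phi> u) (\<phi> v) \<longleftrightarrow> opposite n G' (\<psi> u) (\<psi> v)"
    if "u \<in> elements G" "v \<in> elements G" for u v
    using opposite_iff_nostammer[OF phi that] opposite_iff_nostammer[OF psi that]
    by (auto simp: joins_walk)
  show ?thesis
    using epi_kernel_le[OF G' phi psi opp uv] epi_kernel_le[OF G' psi phi opp[symmetric] uv] by blast
qed

text \<open>In the application \<open>\<psi> = \<phi> \<circ> g\<close>, with \<open>g\<close> a root elation of \<open>xs\<close>. Agreement at the inner elements
  of the root is immediate and spreads to their opposites. The two ends are opposite only to each
  other in the apartment, so an element \<open>w\<close> outside it is used: \<open>w\<close> is incident with \<open>xs ! 1\<close>, and
  it is opposite to the end of the root and to the element \<open>ws ! (n + 2)\<close>, which in turn is opposite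
  to \<open>xs ! 2\<close>. Here \<open>n \<ge> 3\<close> is needed for \<open>xs ! 2\<close> to be an inner element.\<close>

lemma agreeing_apartment_exists:
  assumes xs: "visible xs" "length xs = n + 1"
    and same: "\<And>i u. 1 \<le> i \<Longrightarrow> i < n \<Longrightarrow> incident G (xs ! i) u \<Longrightarrow> \<psi> u = \<phi> u"
    and y: "incident G (hd xs) y" "\<phi> y \<noteq> \<phi> (xs ! 1)" "\<psi> y \<noteq> \<psi> (xs ! 1)"
  shows "\<exists>ws. agreeing_apartment ws"
proof -
  obtain ws where ws: "apartment ws" "take (n + 1) ws = xs" "ws ! (2 * n - 1) = y"
    using apartment_through[OF xs y] .
  then have ws': "visible ws" "length ws = 2 * n + 1" "hd ws = last ws"
    by (auto simp: apartment_def)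
  have nth: "xs ! i = ws ! i" if "i \<le> n" for i using that ws(2) by auto
  have mid: "agree (xs ! i)" if "1 \<le> i" "i < n" for i
    using same[OF that] by (auto simp: agree_def)
  have inc: "incident G (xs ! 1) (xs ! 0)" "incident G (xs ! 1) (xs ! 2)"
    using walk_nth[of G xs 0] walk_nth[of G xs 1] xs n
    by (auto simp: visible_def numeral_2_eq_2 intro: incident_sym)
  have "\<phi> (xs ! 1) \<in> elements G'"
    using phi incident_elements[OF polygon_rank2[OF G] inc(1)] by (auto simp: epimorphism_def)
  then obtain w' where w': "incident G' (\<phi> (xs ! 1)) w'" "w' \<noteq> \<phi> (xs ! 0)" "w' \<noteq> \<phi> (xs ! 2)"
    using polygon_thick[OF G'] by blast
  then obtain w where w: "incident G (xs ! 1) w" "\<phi> w = w'"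
    using epi_local_surj[OF n G G' phi] incident_elements[OF polygon_rank2[OF G] inc(1)] by blast
  have psi_eq: "\<psi> w = \<phi> w" "\<psi> (xs ! 0) = \<phi> (xs ! 0)" "\<psi> (xs ! 2) = \<phi> (xs ! 2)"
    using same[of 1] n w inc by auto
  have wel: "w \<in> elements G" using incident_elements[OF polygon_rank2[OF G] w(1)] by simp
  have "agree w"
  proof -
    \<comment> \<open>The path \<open>w, xs ! 1, xs ! 0\<close> continues along the second half of the apartment, backwards.\<close>
    define us where "us = take (n - 1) (rev ws)"
    have "ws \<noteq> []" using ws' by auto
    then have last: "last ws = xs ! 0" using ws'(3) nth[of 0] by (simp add: hd_conv_nth)
    have us: "visible us" "length us = n - 1" "us \<noteq> []" "hd us = xs ! 0" "last us = ws ! (n + 2)"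
      "1 < length us \<Longrightarrow> us ! 1 = ws ! (2 * n - 1)"
      using ws' n last
      by (auto simp: us_def hd_rev hd_conv_nth rev_nth last_take_nth intro!: visible_take visible_rev
          arg_cong[where f = "nth ws"])
    have ne: "f w \<noteq> f (xs ! 0)" "1 < length us \<Longrightarrow> f (xs ! 1) \<noteq> f (us ! 1)" if "f = \<phi> \<or> f = \<psi>" for f
      using that w w' psi_eq us(6) ws(3) y by auto
    have "us ! 0 = xs ! 0" using us by (simp add: hd_conv_nth)
    moreover have "walk G (w # xs ! 1 # us)"
      using us w inc wel incident_elements[OF polygon_rank2[OF G] w(1)]
      by (auto simp: walk_Cons visible_def intro: incident_sym)
    ultimately have vs: "visible (w # xs ! 1 # us)"
      using us ne by (auto simp: visible_def nostammer_Cons)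
    have "agree (ws ! (n + 2))"
      using apartment_opposite[OF ws'(1,2), of 2] mid[of 2] nth[of 2] n by auto
    then show ?thesis
      using agree_opposite[OF visible_rev[OF vs]] us n by (auto simp: last_rev hd_append hd_rev)
  qed
  moreover have "visible (w # tl xs)"
  proof -
    have "visible (tl xs)" using visible_drop[OF xs(1), of 1] xs n by (simp add: drop_Suc)
    moreover have "tl xs \<noteq> []" "hd (tl xs) = xs ! 1" "tl xs ! 1 = xs ! 2"
      using xs n by (cases xs; cases "tl xs"; auto)+
    ultimately show ?thesis
      using w w' wel psi_eq by (auto simp: visible_def nostammer_Cons walk_Cons intro: incident_sym)
  qed
  ultimately have "agree (last (w # tl xs))" using xs n by (intro agree_opposite) auto
  moreover have "last (w # tl xs) = ws ! n"
    using xs n nth[of n] by (cases xs) (auto simp: last_conv_nth)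
  ultimately have "agree (xs ! n)" using nth by simp
  moreover from this have "agree (xs ! 0)"
    using apartment_opposite[OF ws'(1,2), of 0] nth[of 0] nth[of n] by simp
  ultimately have "agree (xs ! i)" if "i \<le> n" for i
    using mid[of i] that by (cases "i = 0"; cases "i = n") auto
  then have "agreeing_apartment ws"
    using ws xs by (intro agreeing_apartmentI) (auto simp: in_set_conv_nth)
  then show ?thesis by blast
qed

end

section \<open>Automorphisms that descend\<close>

lemma automorphism_incident:
  assumes "rank2_geometry G" "automorphism G g" "incident G x y"
  shows "incident G (g x) (g y)"
  using assms incident_elements[OF assms(1,3)] by (auto simp: automorphism_def)

lemma automorphism_elements:
  assumes "automorphism G g"
  shows "g x \<in> elements G \<longleftrightarrow> x \<in> elements G"
  using assms permutes_in_image by (fastforce simp: automorphism_def)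

lemma automorphism_points:
  assumes "automorphism G g"
  shows "g x \<in> points G \<longleftrightarrow> x \<in> points G"
proof -
  have "inj g" "g ` points G = points G"
    using assms by (auto simp: automorphism_def permutes_inj)
  then show ?thesis by (metis inj_image_mem_iff)
qed

lemma epi_automorphism:
  assumes "rank2_geometry G" "epimorphism G G' \<phi>" "automorphism G g"
  shows "epimorphism G G' (\<phi> \<circ> g)"
proof -
  have "g ` elements G = elements G" "g ` points G = points G" "g ` lines G = lines G"
    using assms(3) permutes_image by (auto simp: automorphism_def)
  then show ?thesis
    using assms(2) automorphism_incident[OF assms(1,3)]
    by (auto simp: epimorphism_def simp flip: image_image image_comp)
qed

lemma epi_points:
  assumes "rank2_geometry G'" "epimorphism G G' \<phi>" "x \<in> elements G"
  shows "\<phi> x \<in> points G' \<longleftrightarrow> x \<in> points G"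
proof -
  have "points G' \<inter> lines G' = {}" "\<phi> ` points G \<subseteq> points G'" "\<phi> ` lines G \<subseteq> lines G'"
    using assms by (auto simp: rank2_geometry_def epimorphism_def)
  then show ?thesis using assms(3) unfolding elements_def by blast
qed

text \<open>A permutation of the fibres induces a bijection; local surjectivity makes both the bijection
  and its inverse preserve incidence.\<close>

lemma automorphism_descends:
  assumes n: "n \<ge> 3" and G: "generalized_polygon n G" and G': "generalized_polygon n G'"
    and e: "epimorphism G G' \<phi>" and g: "automorphism G g"
    and ker: "\<And>u v. u \<in> elements G \<Longrightarrow> v \<in> elements G \<Longrightarrow>
      \<phi> u = \<phi> v \<longleftrightarrow> \<phi> (g u) = \<phi> (g v)"
  obtains h where "automorphism G' h" "\<And>u. u \<in> elements G \<Longrightarrow> h (\<phi> u) = \<phi> (g u)"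
proof -
  note r = polygon_rank2[OF G] and r' = polygon_rank2[OF G']
  note gel = automorphism_elements[OF g]
  have phi_el: "\<phi> u \<in> elements G'" if "u \<in> elements G" for u
    using e that by (auto simp: epimorphism_def)
  have gsurj: "\<exists>u\<in>elements G. g u = w" if "w \<in> elements G" for w
  proof -
    have "g ` elements G = elements G" using g permutes_image by (auto simp: automorphism_def)
    then show ?thesis using that by (metis imageE)
  qed
  \<comment> \<open>The identity outside the elements, as for every automorphism.\<close>
  define h where "h x = (if x \<in> elements G' then \<phi> (g (SOME u. u \<in> elements G \<and> \<phi> u = x)) else x)" for x
  have h: "h (\<phi> u) = \<phi> (g u)" if u: "u \<in> elements G" for u
  proof -
    let ?v = "SOME v. v \<in> elements G \<and> \<phi> v = \<phi> u"
    have "?v \<in> elements G \<and> \<phi> ?v = \<phi> u" 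
      by (rule someI[where x = u]) (simp add: u)
    then have "\<phi> (g ?v) = \<phi> (g u)" using ker u by blast
    then show ?thesis using phi_el[OF u] by (simp add: h_def)
  qed
  have hel: "h x \<in> elements G'" if "x \<in> elements G'" for x
    using epi_surj[OF e that] h phi_el gel by metis
  have "inj_on h (elements G')"
  proof (rule inj_onI)
    fix x y assume xy: "x \<in> elements G'" "y \<in> elements G'" and eq: "h x = h y"
    obtain u v where "u \<in> elements G" "\<phi> u = x" "v \<in> elements G" "\<phi> v = y"
      using epi_surj[OF e xy(1)] epi_surj[OF e xy(2)] by blast
    then show "x = y" using eq h[of u] h[of v] ker[of u v] by simp
  qed
  moreover have hsurj: "\<exists>x\<in>elements G'. h x = y" if "y \<in> elements G'" for y
    using epi_surj[OF e that] gsurj h phi_el by metis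
  then have "h ` elements G' = elements G'" using hel by (auto simp: image_iff)
  ultimately have "bij_betw h (elements G') (elements G')" by (simp add: bij_betw_def)
  then have perm: "h permutes elements G'"
    by (rule bij_imp_permutes) (simp add: h_def)
  have hpt: "h x \<in> points G' \<longleftrightarrow> x \<in> points G'" if "x \<in> elements G'" for x
  proof -
    obtain u where "u \<in> elements G" "\<phi> u = x" using epi_surj[OF e \<open>x \<in> elements G'\<close>] by blast
    then show ?thesis
      using h[of u] gel[of u] epi_points[OF r' e, of u] epi_points[OF r' e, of "g u"]
        automorphism_points[OF g, of u] by simp
  qed
  have hln: "h x \<in> lines G' \<longleftrightarrow> x \<in> lines G'" if "x \<in> elements G'" for x
    using hpt[OF that] hel[OF that] that r' by (auto simp: elements_def rank2_geometry_def)
  have "h ` points G' = points G'" "h ` lines G' = lines G'"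
    using hpt hln hsurj unfolding elements_def by (blast, blast)
  moreover have "incident G' (h x) (h y) \<longleftrightarrow> incident G' x y"
    if x: "x \<in> elements G'" and y: "y \<in> elements G'" for x y
  proof -
    obtain u v where u: "u \<in> elements G" "\<phi> u = x" and v: "v \<in> elements G" "\<phi> v = y"
      using epi_surj[OF e x] epi_surj[OF e y] by blast
    show ?thesis
    proof
      assume "incident G' x y"
      then obtain w where w: "incident G u w" "\<phi> w = y"
        using epi_local_surj[OF n G G' e] u by blast
      then have "incident G' (\<phi> (g u)) (\<phi> (g w))"
        using e automorphism_incident[OF r g] by (auto simp: epimorphism_def)
      then show "incident G' (h x) (h y)"
        using h[of u] h[of w] u w incident_elements[OF r w(1)] by simp
    next
      assume "incident G' (h x) (h y)"
      then have "incident G' (\<phi> (g u)) (\<phi> (g v))" using h[of u] h[of v] u v by simp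
      then obtain w where w: "incident G (g u) w" "\<phi> w = \<phi> (g v)"
        using epi_local_surj[OF n G G' e, of "g u"] u gel[of u] by blast
      then obtain t where t: "t \<in> elements G" "g t = w"
        using gsurj incident_elements[OF r w(1)] by blast
      then have "incident G u t" using g w u by (auto simp: automorphism_def)
      moreover have "\<phi> t = y" using ker[of t v] t v w by simp
      ultimately show "incident G' x y" using e u by (auto simp: epimorphism_def)
    qed
  qed
  ultimately have "automorphism G' h" using perm by (auto simp: automorphism_def)
  then show thesis using that h by blast
qed

text \<open>The hypotheses on \<open>y\<close> and \<open>g y\<close> cannot be dropped: in the projective plane over a field with a
  valuation, for example, the elation \<open>x \<mapsto> x + t\<close> preserves the fibres of reduction only if \<open>t\<close>
  is integral.\<close>

lemma root_elation_descends:
  assumes n: "n \<ge> 3" and G: "generalized_polygon n G" and G': "generalized_polygon n G'"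
    and e: "epimorphism G G' \<phi>" and xs: "walk G xs" "nostammer \<phi> xs" "length xs = n + 1"
    and g: "g \<in> root_group n G xs"
    and y: "incident G (xs ! 0) y" "\<phi> y \<noteq> \<phi> (xs ! 1)" "\<phi> (g y) \<noteq> \<phi> (xs ! 1)"
  obtains h where "h \<in> root_group n G' (map \<phi> xs)" "\<And>u. u \<in> elements G \<Longrightarrow> h (\<phi> u) = \<phi> (g u)"
proof -
  note r = polygon_rank2[OF G]
  have aut: "automorphism G g"
    and gfix: "\<And>i u. 1 \<le> i \<Longrightarrow> i < n \<Longrightarrow> incident G (xs ! i) u \<Longrightarrow> g u = u"
    using g by (auto simp: root_group_def)
  have fixed: "g (xs ! i) = xs ! i" if "i \<le> n" for i
  proof (cases "i < 2")
    case True
    then have "incident G (xs ! (i + 1)) (xs ! i)"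
      using walk_nth[OF xs(1), of i] xs n by (auto intro: incident_sym)
    then show ?thesis using gfix[of "i + 1"] True n by auto
  next
    case False
    then have "incident G (xs ! (i - 1)) (xs ! i)"
      using walk_nth[OF xs(1), of "i - 1"] xs that by auto
    then show ?thesis using gfix[of "i - 1"] False that by auto
  qed
  interpret two_epimorphisms n G G' \<phi> "\<phi> \<circ> g"
    using n G G' e epi_automorphism[OF r e aut] by unfold_locales
  have "nostammer (\<phi> \<circ> g) xs" using xs fixed by (auto simp: nostammer_def)
  then have "visible xs" using xs by (simp add: visible_def)
  moreover have "hd xs = xs ! 0" using xs by (simp add: walk_def hd_conv_nth)
  ultimately obtain ws where "agreeing_apartment ws"
    using agreeing_apartment_exists[of xs y] xs gfix y fixed[of 1] n by auto
  then have "\<phi> u = \<phi> v \<longleftrightarrow> \<phi> (g u) = \<phi> (g v)" if "u \<in> elements G" "v \<in> elements G" for u v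
    using kernels_agree that by simp
  then obtain h where h: "automorphism G' h" "\<And>u. u \<in> elements G \<Longrightarrow> h (\<phi> u) = \<phi> (g u)"
    using automorphism_descends[OF n G G' e aut] by blast
  have "h u' = u'" if "1 \<le> i" "i < n" "incident G' (map \<phi> xs ! i) u'" for i u'
  proof -
    have "xs ! i \<in> elements G" using xs that by (auto simp: walk_def)
    moreover have "incident G' (\<phi> (xs ! i)) u'" using that xs by simp
    ultimately obtain u where u: "incident G (xs ! i) u" "\<phi> u = u'"
      using epi_local_surj[OF n G G' e] by blast
    then show ?thesis using h(2) gfix[OF that(1,2)] incident_elements[OF r u(1)] by metis
  qed
  then have "h \<in> root_group n G' (map \<phi> xs)" using h(1) by (auto simp: root_group_def)
  then show thesis using that h(2) by blast
qed

theorem mainTheorem1: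
  fixes n :: nat and G :: "'a geometry" and G' :: "'b geometry" and \<phi> :: "'a \<Rightarrow> 'b"
  assumes "n \<ge> 3"
    and "generalized_polygon n G" and "generalized_polygon n G'"
    and "epimorphism G G' \<phi>"
    and "moufang_polygon n G"
  shows "moufang_polygon n G'"
proof -
  note n = assms(1) and G = assms(2) and G' = assms(3) and e = assms(4)
  have "moufang_root n G' xs'" if root: "root n G' xs'" for xs'
    unfolding moufang_root_def
  proof (intro conjI allI impI)
    fix y' z'
    assume y': "incident G' (xs' ! 0) y'" "y' \<noteq> xs' ! 1" and z': "incident G' (xs' ! 0) z'" "z' \<noteq> xs' ! 1"
    have xs': "walk G' xs'" "nostammer id xs'" "length xs' = n + 1"
      using root by (auto simp: root_def non_stammering_path_iff)
    obtain xs where xs: "walk G xs" "map \<phi> xs = xs'" using epi_lift_walk[OF n G G' e xs'(1)] by blast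
    then have len: "length xs = n + 1" and ns: "nostammer \<phi> xs"
      using xs' by (auto simp: nostammer_map)
    have el: "xs ! 0 \<in> elements G" using xs len by (auto simp: walk_def)
    have nth: "xs' ! 0 = \<phi> (xs ! 0)" "xs' ! 1 = \<phi> (xs ! 1)" using xs len n by auto
    obtain y z where y: "incident G (xs ! 0) y" "\<phi> y = y'" and z: "incident G (xs ! 0) z" "\<phi> z = z'"
      using epi_local_surj[OF n G G' e el] y' z' nth by metis
    have "root n G xs"
      using xs len ns by (auto simp: root_def non_stammering_path_iff nostammer_def)
    then have "moufang_root n G xs" using assms(5) by (simp add: moufang_polygon_def)
    then obtain g where g: "g \<in> root_group n G xs" "g y = z"
      using y z y' z' nth unfolding moufang_root_def by metis
    obtain h where h: "h \<in> root_group n G' (map \<phi> xs)" "\<And>u. u \<in> elements G \<Longrightarrow> h (\<phi> u) = \<phi> (g u)"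
      using root_elation_descends[OF n G G' e xs(1) ns len g(1) y(1)] y z y' z' g nth by metis
    have "h y' = z'"
      using h(2)[of y] y z g incident_elements[OF polygon_rank2[OF G] y(1)] by simp
    then show "\<exists>h\<in>root_group n G' xs'. h y' = z'" using h xs by blast
  qed (rule root)
  then show ?thesis using n G' by (simp add: moufang_polygon_def)
qed

end
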